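(* Let $X^{\gamma_3}_3$ be the following linear combination of eleven $1$-vector micro-graphs over $\mathbb{R}^3$ (each is given by its coefficient, its list of directed edges $(\text{tail},\text{head})$ in which the three edges with a common tail are ordered as listed, and its sink): $$\begin{array}{rll} 16 & [(0,4),(0,5),(0,6),(5,0),(5,1),(5,6),(6,0),(6,2),(6,3)] & \text{sink }2\\ 24 & [(0,4),(0,5),(0,6),(5,0),(5,1),(5,6),(6,1),(6,2),(6,3)] & \text{sink }2\\ 16 & [(0,4),(0,5),(0,6),(5,0),(5,1),(5,2),(6,1),(6,3),(6,5)] & \text{sink }2\\ -16 & [(0,4),(0,5),(0,6),(5,0),(5,1),(5,2),(6,1),(6,3),(6,5)] & \text{sink }4\\ 12 & [(0,4),(0,5),(0,6),(5,1),(5,2),(5,6),(6,1),(6,2),(6,3)] & \text{sink }3\\ -12 & [(0,4),(0,5),(0,6),(5,1),(5,2),(5,6),(6,1),(6,2),(6,3)] & \text{sink }4\\ 24 & [(4,0),(4,1),(4,6),(5,0),(5,1),(5,2),(6,0),(6,2),(6,3)] & \text{sink }3\\ -24 & [(4,0),(4,1),(4,6),(5,0),(5,2),(5,4),(6,0),(6,1),(6,3)] & \text{sink }2\\ 8 & [(4,0),(4,1),(4,5),(5,0),(5,2),(5,6),(6,0),(6,3),(6,4)] & \text{sink }1\\ -8 & [(4,0),(4,1),(4,5),(5,2),(5,3),(5,6),(6,0),(6,1),(6,4)] & \text{sink }2\\ 8 & [(0,4),(0,5),(0,6),(5,0),(5,1),(5,6),(6,2),(6,3),(6,6)] & \text{sink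 }2 \end{array}$$ Let $\vec{X}([\varrho],[a])$ be the vector field on $\mathbb{R}^3$ encoded by $X^{\gamma_3}_3$. Then $\vec X$ trivializes the Kontsevich tetrahedral flow on the space of Nambu-determinant Poisson bi-vectors $P=P(\varrho,[a])$ over $\mathbb{R}^3$: $$Q_{\gamma_3}\bigl(P(\varrho,[a])\bigr)=[\![P(\varrho,[a]),\vec{X}([\varrho],[a])]\!].$$
   Context: Coordinates on $\mathbb{R}^3$ are $x^1,x^2,x^3$; $\partial_i=\partial/\partial x^i$; repeated indices are summed from $1$ to $3$; $\varepsilon^{ijk}$ is the Levi-Civita symbol with $\varepsilon^{123}=1$. Nambu-determinant bi-vector: $P(\varrho,[a])$ has components $P^{jk}=\varrho\,\varepsilon^{ijk}\,\partial_i a$, i.e. $\{f,g\}=\varrho\,\varepsilon^{ijk}\,\partial_i a\,\partial_j f\,\partial_k g=\varrho\cdot\det\partial(a,f,g)/\partial(x^1,x^2,x^3)$, with $\varrho,a$ functions on $\mathbb{R}^3$. The function $a$ is called the Casimir. Schouten bracket convention: for a bi-vector $P$ and a vector field $X$, $[\![X,P]\!]=L_XP$ and $[\![P,X]\!]=-L_XP$, i.e. $[\![P,X]\!](f,g)=-X(P(f,g))+P(X(f),g)+P(f,X(g))$. Tetrahedral flow $\dot P=Q_{\gamma_3}(P)$: $Q_{\gamma_3}(P)$ is the bi-vector $Q_{\gamma_3}(P)(f,g)=Q^{ij}\,\partial_i f\,\partial_j g$ with $$Q^{ij}=\partial_a\partial_b\partial_cP^{ij}\,\partial_rP^{ap}\,\partial_pP^{bq}\,\partial_qP^{cr}-3\bigl(\partial_b\partial_cP^{ia}\,\partial_a\partial_rP^{jd}\,\partial_dP^{be}\,\partial_eP^{cr}+\partial_s\partial_tP^{ia}\,\partial_aP^{bc}\,\partial_b\partial_uP^{js}\,\partial_cP^{tu}\bigr)$$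 (in this formula $a,b,c,\dots$ are summation indices). $1$-vector micro-graphs over $\mathbb{R}^3$ (as used here): directed graphs on seven vertices: three trident vertices, each with three ordered outgoing edges; three terminal (Casimir) vertices, with no outgoing edges and in-degree at least $1$; and one sink, with no outgoing edges and in-degree exactly $1$. An edge from a vertex to itself (a tadpole) is allowed. Such a micro-graph encodes a vector field with differential-polynomial components in $\varrho,a$ as follows: attach to each edge a summation index running over $1,2,3$; put in each trident vertex $\varrho\cdot\varepsilon^{ijk}$, where $i,j,k$ are the indices of its first, second, third outgoing edges; put in each terminal vertex a copy of $a$; put in the sink the argument $f$ of the vector field. Each edge with index $i$ acts by $\partial_i$ on the content ($\varrho$, $a$ or $f$) of its head vertex. Multiply the contents of all vertices and sum over all indices. The result is $\vec X(f)$; extend by linearity to linear combinations of micro-graphs.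
   Formalization: The printed equation fails by a factor of 8 with the given normalisation of the flow; what is proved is 8·Q(P) = [[P, X]]. For ρ = 1+x³, a = x¹+(x¹)²(x³)²+(x²)³x³ at the origin, the 12-components of Q(P) and [[P, X]] are 6 and 48. *)

theory Defs
  imports "HOL-Analysis.Analysis"
begin

section \<open>Smooth functions on three-space\<close>

type_synonym scalar_field = "real^3 \<Rightarrow> real"

definition partial :: "3 \<Rightarrow> scalar_field \<Rightarrow> scalar_field" where
  "partial i f = (\<lambda>x. deriv (\<lambda>t. f (x + t *\<^sub>R axis i 1)) 0)"

text \<open>All iterated partial derivatives are (Frechet) differentiable, hence continuous; this is
  equivalent to being of class \<open>C\<^sup>\<infinity>\<close>.\<close>

definition smooth :: "scalar_field \<Rightarrow> bool" where
  "smooth f \<longleftrightarrow> (\<forall>is. (foldr partial is f) differentiable_on UNIV)"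

text \<open>The index type \<^typ>\<open>3\<close> has exactly the elements 1, 2, 3 (its numeral 3 coincides with 0).\<close>

definition levi_civita :: "3 \<Rightarrow> 3 \<Rightarrow> 3 \<Rightarrow> real" where
  "levi_civita i j k =
     (if (i, j, k) \<in> {(1, 2, 3), (2, 3, 1), (3, 1, 2)} then 1
      else if (i, j, k) \<in> {(1, 3, 2), (3, 2, 1), (2, 1, 3)} then - 1
      else 0)"

section \<open>Bi-vectors, the Schouten bracket and the tetrahedral flow\<close>

text \<open>Bi-vectors are given by their components; \<open>bivector_apply P f g\<close> is the function
  \<open>P f g = P\<^sup>i\<^sup>j \<partial>\<^sub>i f \<partial>\<^sub>j g\<close>, without a factor 1/2. A vector field is represented by the
  derivation it induces on functions.\<close>

type_synonym bivector = "3 \<Rightarrow> 3 \<Rightarrow> scalar_field"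
type_synonym vector_field = "scalar_field \<Rightarrow> scalar_field"

definition bivector_apply :: "bivector \<Rightarrow> scalar_field \<Rightarrow> scalar_field \<Rightarrow> scalar_field" where
  "bivector_apply P f g =
     (\<lambda>x. \<Sum>i\<in>UNIV. \<Sum>j\<in>UNIV. P i j x * partial i f x * partial j g x)"

definition nambu :: "scalar_field \<Rightarrow> scalar_field \<Rightarrow> bivector" where
  "nambu \<rho> a j k = (\<lambda>x. \<Sum>i\<in>UNIV. \<rho> x * levi_civita i j k * partial i a x)"

text \<open>The bracket of a bi-vector \<open>P\<close> with a vector field \<open>X\<close>, equal to minus the Lie derivative
  of \<open>P\<close> along \<open>X\<close>.\<close>

definition schouten :: "bivector \<Rightarrow> vector_field \<Rightarrow> scalar_field \<Rightarrow> scalar_field \<Rightarrow> scalar_field" where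
  "schouten P X f g =
     (\<lambda>x. - X (bivector_apply P f g) x + bivector_apply P (X f) g x + bivector_apply P f (X g) x)"

text \<open>Normalisation of the flow: coefficient 1 of the first sum and -3 of the other two.
  The graph coefficients \<open>X_tetra\<close> below belong to the normalisation 8 : -24, so that the bracket
  of \<open>nambu \<rho> a\<close> with the encoded vector field is 8 times \<open>tetra_flow (nambu \<rho> a)\<close>, not
  \<open>tetra_flow (nambu \<rho> a)\<close> itself. For \<open>\<rho> = 1 + x\<^sup>3\<close> and
  \<open>a = x\<^sup>1 + (x\<^sup>1)^2 (x\<^sup>3)^2 + (x\<^sup>2)^3 x\<^sup>3\<close> (superscripts on \<open>x\<close> are coordinate indices) the 12-components
  of the flow and of the bracket at the origin are 6 and 48.\<close>

definition tetra_flow :: "bivector \<Rightarrow> bivector" where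
  "tetra_flow P i j = (\<lambda>x.
     (\<Sum>a\<in>UNIV. \<Sum>b\<in>UNIV. \<Sum>c\<in>UNIV. \<Sum>p\<in>UNIV. \<Sum>q\<in>UNIV. \<Sum>r\<in>UNIV.
        partial a (partial b (partial c (P i j))) x * partial r (P a p) x
          * partial p (P b q) x * partial q (P c r) x)
     - 3 * (
     (\<Sum>a\<in>UNIV. \<Sum>b\<in>UNIV. \<Sum>c\<in>UNIV. \<Sum>d\<in>UNIV. \<Sum>e\<in>UNIV. \<Sum>r\<in>UNIV.
        partial b (partial c (P i a)) x * partial a (partial r (P j d)) x
          * partial d (P b e) x * partial e (P c r) x)
     + (\<Sum>a\<in>UNIV. \<Sum>b\<in>UNIV. \<Sum>c\<in>UNIV. \<Sum>s\<in>UNIV. \<Sum>t\<in>UNIV. \<Sum>u\<in>UNIV.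
        partial s (partial t (P i a)) x * partial a (P b c) x
          * partial b (partial u (P j s)) x * partial c (P t u) x)))"

section \<open>Micro-graphs\<close>

text \<open>A micro-graph on the vertices 0, ..., 6 is given by its directed edges (tail, head) and its
  sink; the order of the edges with a common tail is the order in which they occur in the list.\<close>

datatype micrograph = Micrograph (edges: "(nat \<times> nat) list") (sink: nat)

text \<open>Positions in the edge list of the edges leaving, respectively entering, a vertex.\<close>

definition out_edges :: "micrograph \<Rightarrow> nat \<Rightarrow> nat list" where
  "out_edges G v = filter (\<lambda>e. fst (edges G ! e) = v) [0..<length (edges G)]"

definition in_edges :: "micrograph \<Rightarrow> nat \<Rightarrow> nat list" where
  "in_edges G v = filter (\<lambda>e. snd (edges G ! e) = v) [0..<length (edges G)]"

definition vector_micrograph :: "micrograph \<Rightarrow> bool" where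
  "vector_micrograph G \<longleftrightarrow>
     set (edges G) \<subseteq> {0..<7} \<times> {0..<7} \<and>
     (\<exists>T C. {0..<7} = T \<union> C \<union> {sink G} \<and> T \<inter> C = {} \<and> sink G \<notin> T \<union> C \<and>
        card T = 3 \<and> card C = 3 \<and>
        (\<forall>v\<in>T. length (out_edges G v) = 3) \<and>
        (\<forall>v\<in>C. out_edges G v = [] \<and> length (in_edges G v) \<ge> 1)) \<and>
     out_edges G (sink G) = [] \<and> length (in_edges G (sink G)) = 1"

text \<open>\<open>\<iota>\<close> assigns a summation index to each position in the edge list.\<close>

definition vertex_content ::
  "micrograph \<Rightarrow> scalar_field \<Rightarrow> scalar_field \<Rightarrow> scalar_field \<Rightarrow> (nat \<Rightarrow> 3) \<Rightarrow> nat \<Rightarrow> scalar_field" where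
  "vertex_content G \<rho> a f \<iota> v =
     (if v = sink G then f
      else case map \<iota> (out_edges G v) of
             [i, j, k] \<Rightarrow> (\<lambda>x. \<rho> x * levi_civita i j k)
           | _ \<Rightarrow> a)"

definition graph_field :: "micrograph \<Rightarrow> scalar_field \<Rightarrow> scalar_field \<Rightarrow> vector_field" where
  "graph_field G \<rho> a f =
     (\<lambda>x. \<Sum>\<iota> \<in> {0..<length (edges G)} \<rightarrow>\<^sub>E (UNIV :: 3 set).
        \<Prod>v\<in>{0..<7}. foldr partial (map \<iota> (in_edges G v)) (vertex_content G \<rho> a f \<iota> v) x)"

definition encoded_field ::
  "(real \<times> micrograph) list \<Rightarrow> scalar_field \<Rightarrow> scalar_field \<Rightarrow> vector_field" where
  "encoded_field L \<rho> a f = (\<lambda>x. \<Sum>(c, G)\<leftarrow>L. c * graph_field G \<rho> a f x)"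

definition X_tetra :: "(real \<times> micrograph) list" where
  "X_tetra =
    [(16, Micrograph [(0,4),(0,5),(0,6),(5,0),(5,1),(5,6),(6,0),(6,2),(6,3)] 2),
     (24, Micrograph [(0,4),(0,5),(0,6),(5,0),(5,1),(5,6),(6,1),(6,2),(6,3)] 2),
     (16, Micrograph [(0,4),(0,5),(0,6),(5,0),(5,1),(5,2),(6,1),(6,3),(6,5)] 2),
     (-16, Micrograph [(0,4),(0,5),(0,6),(5,0),(5,1),(5,2),(6,1),(6,3),(6,5)] 4),
     (12, Micrograph [(0,4),(0,5),(0,6),(5,1),(5,2),(5,6),(6,1),(6,2),(6,3)] 3),
     (-12, Micrograph [(0,4),(0,5),(0,6),(5,1),(5,2),(5,6),(6,1),(6,2),(6,3)] 4),
     (24, Micrograph [(4,0),(4,1),(4,6),(5,0),(5,1),(5,2),(6,0),(6,2),(6,3)] 3),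
     (-24, Micrograph [(4,0),(4,1),(4,6),(5,0),(5,2),(5,4),(6,0),(6,1),(6,3)] 2),
     (8, Micrograph [(4,0),(4,1),(4,5),(5,0),(5,2),(5,6),(6,0),(6,3),(6,4)] 1),
     (-8, Micrograph [(4,0),(4,1),(4,5),(5,2),(5,3),(5,6),(6,0),(6,1),(6,4)] 2),
     (8, Micrograph [(0,4),(0,5),(0,6),(5,0),(5,1),(5,6),(6,2),(6,3),(6,6)] 2)]"

lemma vector_micrographI:
  assumes "set (edges G) \<subseteq> {0..<7} \<times> {0..<7}"
    and "{0..<7} = set ts \<union> set cs \<union> {sink G}" and "distinct (ts @ cs @ [sink G])"
    and "length ts = 3" and "length cs = 3"
    and "\<forall>v\<in>set ts. length (out_edges G v) = 3"
    and "\<forall>v\<in>set cs. out_edges G v = [] \<and> length (in_edges G v) \<ge> 1"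
    and "out_edges G (sink G) = []" and "length (in_edges G (sink G)) = 1"
  shows "vector_micrograph G"
  unfolding vector_micrograph_def using assms
  by (intro conjI exI[of _ "set ts"] exI[of _ "set cs"]) (auto simp: distinct_card)

lemma X_tetra_vector_micrographs: "\<forall>(c, G) \<in> set X_tetra. vector_micrograph G"
proof -
  define ts where "ts G = remdups (map fst (edges G))" for G
  define cs where "cs G = filter (\<lambda>v. v \<notin> set (ts G) \<and> v \<noteq> sink G) [0..<7]" for G
  have "\<forall>G \<in> set (map snd X_tetra).
      set (edges G) \<subseteq> set (List.product [0..<7] [0..<7]) \<and>
      set [0..<7] = set (ts G) \<union> set (cs G) \<union> {sink G} \<and>
      distinct (ts G @ cs G @ [sink G]) \<and> length (ts G) = 3 \<and> length (cs G) = 3 \<and>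
      (\<forall>v\<in>set (ts G). length (out_edges G v) = 3) \<and>
      (\<forall>v\<in>set (cs G). out_edges G v = [] \<and> length (in_edges G v) \<ge> 1) \<and>
      out_edges G (sink G) = [] \<and> length (in_edges G (sink G)) = 1"
    unfolding ts_def cs_def X_tetra_def list.map snd_conv by code_simp
  then have "\<forall>G \<in> set (map snd X_tetra). vector_micrograph G"
    by (auto intro!: vector_micrographI[where ts = "ts _" and cs = "cs _"] simp del: atLeastLessThan_upt)
  then show ?thesis by auto
qed

end

theory Submission
  imports Defs
begin

text \<open>
  Both sides of the theorem are differential polynomials: at every point they are polynomial
  expressions in the partial derivatives (jets) of \<open>\<rho>\<close> and \<open>a\<close>, contracted with the gradients of
  \<open>f\<close> and \<open>g\<close>. The theorem holds because the two differential polynomials are equal, coefficient by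
  coefficient, once mixed partial derivatives are identified. No conceptual reason for the eleven
  graph coefficients is used; they solve a linear system, and what has to be done is to expand and
  compare. Each component of the flow has 1504 monomials, so the expansion is carried out by
  rewriting with a small verified polynomial calculus instead of by general algebraic
  simplification.

  Four reductions make this possible.

  \<^item> For smooth functions partial derivatives commute (\<open>partial_commute\<close>), so a jet is a function
    symbol together with a sorted list of directions, and formal total differentiation of a
    differential polynomial represents \<^const>\<open>partial\<close>, as \<open>partial_val\<close> says.

  \<^item> Of the three sums in the tetrahedral flow, the third is minus the second with the two free
    indices exchanged: both contract the same graph, and two edges of one vertex are
    swapped (\<open>val_flow_term3\<close>). Hence the flow is antisymmetric and only three of its nine components have
    to be compared.

  \<^item> A micro-graph sums over \<open>3\<^sup>9\<close> labellings of its nine edges, but the three Levi-Civita symbols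
    leave only the \<open>6\<^sup>3\<close> labellings that are a permutation at every trident. The sink carries exactly
    one derivative, so the encoded operator is a vector field with differential polynomials as
    coefficients (\<open>encoded_field_components\<close>).

  \<^item> For a vector field given by its coefficients the second derivatives of \<open>f\<close> and \<open>g\<close> cancel in the
    Schouten bracket, which leaves the familiar component formula (\<open>schouten_components\<close>).

  What remains is the vanishing of three explicit differential polynomials, \<open>defects_zero\<close>.
\<close>

section \<open>Partial derivatives of smooth functions\<close>

lemma smooth_partial: "smooth f \<Longrightarrow> smooth (partial i f)"
  unfolding smooth_def
proof
  fix ks assume "\<forall>ks. foldr partial ks f differentiable_on UNIV"
  from this[rule_format, of "ks @ [i]"] show "foldr partial ks (partial i f) differentiable_on UNIV"
    by simp
qed

lemma smooth_differentiable: "smooth f \<Longrightarrow> f differentiable at x"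
  unfolding smooth_def by (drule spec[of _ "[]"]) (simp add: differentiable_on_def)

lemma smooth_foldr_partial: "smooth f \<Longrightarrow> smooth (foldr partial ks f)"
  by (induction ks) (simp_all add: smooth_partial)

text \<open>The derivative along a coordinate line, at an arbitrary parameter and not only at 0: the mean value
  theorem below needs it on a whole segment.\<close>

lemma line_has_derivative:
  fixes f :: scalar_field and x :: "real^3"
  assumes "f differentiable at (x + t *\<^sub>R axis i 1)"
  shows "((\<lambda>s. f (x + s *\<^sub>R axis i 1)) has_real_derivative
    frechet_derivative f (at (x + t *\<^sub>R axis i 1)) (axis i 1)) (at t)"
proof -
  let ?y = "x + t *\<^sub>R axis i (1::real)" and ?e = "axis i (1::real)"
  let ?D = "frechet_derivative f (at ?y)"
  have D: "(f has_derivative ?D) (at ?y)"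
    using assms by (simp add: frechet_derivative_works)
  have "((\<lambda>s. x + s *\<^sub>R ?e) has_derivative (\<lambda>s. s *\<^sub>R ?e)) (at t)"
    by (auto intro!: derivative_eq_intros)
  from diff_chain_at[OF this, of f ?D] D
  have "((\<lambda>s. f (x + s *\<^sub>R ?e)) has_derivative (\<lambda>s. ?D (s *\<^sub>R ?e))) (at t)"
    by (simp add: o_def)
  moreover have "?D (s *\<^sub>R ?e) = ?D ?e * s" for s
    using linear_cmul[OF has_derivative_linear[OF D]] by simp
  ultimately show ?thesis
    by (simp add: has_field_derivative_def)
qed

lemma partial_eq_frechet_derivative:
  assumes "f differentiable at x"
  shows "partial i f x = frechet_derivative f (at x) (axis i 1)"
  unfolding partial_def using line_has_derivative[of f x 0 i] assms by (intro DERIV_imp_deriv) simp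

lemma partial_line:
  assumes "f differentiable at (x + t *\<^sub>R axis i 1)"
  shows "((\<lambda>s. f (x + s *\<^sub>R axis i 1)) has_real_derivative partial i f (x + t *\<^sub>R axis i 1)) (at t)"
  using line_has_derivative[OF assms] partial_eq_frechet_derivative[OF assms] by simp

lemma partial_line_0:
  assumes "f differentiable at x"
  shows "((\<lambda>s. f (x + s *\<^sub>R axis i 1)) has_real_derivative partial i f x) (at 0)"
  using partial_line[of f x 0 i] assms by simp

lemma partial_const [simp]: "partial i (\<lambda>x. c) = (\<lambda>x. 0)"
  unfolding partial_def by (simp add: fun_eq_iff)

lemma partial_add:
  assumes "f differentiable at x" "g differentiable at x"
  shows "partial i (\<lambda>x. f x + g x) x = partial i f x + partial i g x"
  unfolding partial_def[of i "\<lambda>x. f x + g x"]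
  using partial_line_0[OF assms(1)] partial_line_0[OF assms(2)] by (intro DERIV_imp_deriv DERIV_add)

lemma partial_mult:
  assumes "f differentiable at x" "g differentiable at x"
  shows "partial i (\<lambda>x. f x * g x) x = partial i f x * g x + f x * partial i g x"
  unfolding partial_def[of i "\<lambda>x. f x * g x"]
  using DERIV_mult[OF partial_line_0[OF assms(1)] partial_line_0[OF assms(2)], of i i]
  by (intro DERIV_imp_deriv) (simp add: algebra_simps)

lemma partial_minus:
  assumes "f differentiable at x"
  shows "partial i (\<lambda>x. - f x) x = - partial i f x"
  unfolding partial_def[of i "\<lambda>x. - f x"]
  using partial_line_0[OF assms] by (intro DERIV_imp_deriv DERIV_minus)

lemma partial_sum:
  assumes "\<And>k. k \<in> A \<Longrightarrow> f k differentiable at x"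
  shows "partial i (\<lambda>x. \<Sum>k\<in>A. f k x) x = (\<Sum>k\<in>A. partial i (f k) x)"
  unfolding partial_def[of i "\<lambda>x. \<Sum>k\<in>A. f k x"]
  using partial_line_0[OF assms] by (intro DERIV_imp_deriv DERIV_sum)

text \<open>The mean value theorem, applied first in direction \<open>i\<close> and then in direction \<open>j\<close>. The left-hand
  side is symmetric in the two directions, which is what makes partial derivatives commute.\<close>

lemma second_difference:
  fixes x :: "real^3" and i j :: 3
  assumes f: "smooth f" and h: "0 < h"
  defines "u \<equiv> axis i (1::real)" and "v \<equiv> axis j (1::real)"
  obtains s t where "0 < s" "s < h" "0 < t" "t < h"
    "f (x + h *\<^sub>R u + h *\<^sub>R v) - f (x + h *\<^sub>R u) - f (x + h *\<^sub>R v) + f x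
      = h * h * partial j (partial i f) (x + s *\<^sub>R u + t *\<^sub>R v)"
proof -
  have d: "g differentiable at y" if "smooth g" for g y
    using that by (rule smooth_differentiable)
  have D: "((\<lambda>s. f (x + s *\<^sub>R u + h *\<^sub>R v) - f (x + s *\<^sub>R u)) has_real_derivative
     partial i f (x + s *\<^sub>R u + h *\<^sub>R v) - partial i f (x + s *\<^sub>R u)) (at s)" for s
    using DERIV_diff[OF partial_line[OF d[OF f], of "x + h *\<^sub>R v" i s] partial_line[OF d[OF f], of x i s]]
    by (simp add: u_def algebra_simps)
  obtain s where s: "0 < s" "s < h"
    "(f (x + h *\<^sub>R u + h *\<^sub>R v) - f (x + h *\<^sub>R u)) - (f (x + 0 *\<^sub>R u + h *\<^sub>R v) - f (x + 0 *\<^sub>R u))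
      = (h - 0) * (partial i f (x + s *\<^sub>R u + h *\<^sub>R v) - partial i f (x + s *\<^sub>R u))"
    using MVT2[OF h D] by blast
  have E: "((\<lambda>t. partial i f (x + s *\<^sub>R u + t *\<^sub>R v)) has_real_derivative
     partial j (partial i f) (x + s *\<^sub>R u + t *\<^sub>R v)) (at t)" for t
    unfolding v_def by (rule partial_line[OF d[OF smooth_partial[OF f]]])
  obtain t where t: "0 < t" "t < h"
    "partial i f (x + s *\<^sub>R u + h *\<^sub>R v) - partial i f (x + s *\<^sub>R u + 0 *\<^sub>R v)
      = (h - 0) * partial j (partial i f) (x + s *\<^sub>R u + t *\<^sub>R v)"
    using MVT2[OF h E] by blast
  show ?thesis
    using s t by (intro that[of s t]) (simp_all add: algebra_simps)
qed

text \<open>The two mixed derivatives take equal values at points that are as close to \<open>x\<close> as desired, and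
  both are continuous.\<close>

lemma partial_commute:
  assumes f: "smooth f"
  shows "partial i (partial j f) = partial j (partial i f)"
proof
  fix x :: "real^3"
  let ?u = "axis i (1::real)" and ?v = "axis j (1::real)"
  let ?g = "partial i (partial j f)" and ?g' = "partial j (partial i f)"
  have cont: "isCont ?g x" "isCont ?g' x"
    using f by (auto intro!: differentiable_imp_continuous_within smooth_differentiable smooth_partial)
  have "\<bar>?g x - ?g' x\<bar> \<le> \<epsilon>" if "0 < \<epsilon>" for \<epsilon>
  proof -
    have "0 < \<epsilon> / 2" using that by simp
    then obtain d d' where d: "0 < d" "\<And>y. dist y x < d \<Longrightarrow> dist (?g y) (?g x) < \<epsilon> / 2"
      and d': "0 < d'" "\<And>y. dist y x < d' \<Longrightarrow> dist (?g' y) (?g' x) < \<epsilon> / 2"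
      using cont unfolding continuous_at_eps_delta by metis
    define h where "h = min d d' / 2"
    have h: "0 < h" using d d' by (simp add: h_def)
    have near: "dist (x + s *\<^sub>R axis k 1 + t *\<^sub>R axis l 1) x < min d d'"
      if "0 < s" "s < h" "0 < t" "t < h" for s t and k l :: 3
    proof -
      have "dist (x + s *\<^sub>R axis k 1 + t *\<^sub>R axis l 1) x
          \<le> norm (s *\<^sub>R axis k (1::real)) + norm (t *\<^sub>R axis l (1::real))"
        by (simp add: dist_norm add.assoc norm_triangle_ineq del: norm_scaleR)
      also have "\<dots> = s + t" using that by (simp add: norm_axis_1)
      also have "\<dots> < min d d'" using that by (simp add: h_def)
      finally show ?thesis .
    qed
    obtain s t where st: "0 < s" "s < h" "0 < t" "t < h" 
      "f (x + h *\<^sub>R ?u + h *\<^sub>R ?v) - f (x + h *\<^sub>R ?u) - f (x + h *\<^sub>R ?v) + f x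
      = h * h * ?g' (x + s *\<^sub>R ?u + t *\<^sub>R ?v)"
      using second_difference[OF f h, of x i j] by blast
    obtain s' t' where st': "0 < s'" "s' < h" "0 < t'" "t' < h" 
      "f (x + h *\<^sub>R ?v + h *\<^sub>R ?u) - f (x + h *\<^sub>R ?v) - f (x + h *\<^sub>R ?u) + f x
      = h * h * ?g (x + s' *\<^sub>R ?v + t' *\<^sub>R ?u)"
      using second_difference[OF f h, of x j i] by blast
    have "f (x + h *\<^sub>R ?u + h *\<^sub>R ?v) = f (x + h *\<^sub>R ?v + h *\<^sub>R ?u)"
      by (simp add: ac_simps)
    then have "h * h * ?g' (x + s *\<^sub>R ?u + t *\<^sub>R ?v) = h * h * ?g (x + s' *\<^sub>R ?v + t' *\<^sub>R ?u)"
      using st(5) st'(5) by linarith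
    then have "?g' (x + s *\<^sub>R ?u + t *\<^sub>R ?v) = ?g (x + s' *\<^sub>R ?v + t' *\<^sub>R ?u)"
      using h by simp
    moreover have "dist (?g (x + s' *\<^sub>R ?v + t' *\<^sub>R ?u)) (?g x) < \<epsilon> / 2"
      using near[OF st'(1-4)] by (intro d(2)) simp
    moreover have "dist (?g' (x + s *\<^sub>R ?u + t *\<^sub>R ?v)) (?g' x) < \<epsilon> / 2"
      using near[OF st(1-4)] by (intro d'(2)) simp
    ultimately show ?thesis
      by (simp add: dist_real_def abs_if split: if_splits)
  qed
  then have "?g x - ?g' x = 0" by (rule dense_eq0_I)
  then show "?g x = ?g' x" by simp
qed

section \<open>Differential polynomials\<close>

text \<open>Indices as a datatype, because rewriting decides equality of constructors in one step and supports
  pattern matching, unlike the numerals of the index type \<^typ>\<open>3\<close>.\<close>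

datatype direction = E1 | E2 | E3

fun index :: "direction \<Rightarrow> 3" where
  "index E1 = 1" | "index E2 = 2" | "index E3 = 3"

lemma index_inject [simp]: "index i = index j \<longleftrightarrow> i = j"
  by (cases i; cases j) simp_all

lemma index_cases: obtains i where "k = index i"
  using exhaust_3[of k] by (metis index.simps)

datatype generator = Rho | Cas

text \<open>A partial derivative of \<open>\<rho>\<close> or \<open>a\<close>; the list is kept sorted by \<open>insert_direction\<close>, so that equal
  derivatives of a smooth function are equal terms.\<close>

datatype jet = Jet generator "direction list"

abbreviation "rho \<equiv> Jet Rho []"
abbreviation "cas \<equiv> Jet Cas []"

fun insert_direction :: "direction \<Rightarrow> direction list \<Rightarrow> direction list" where
  "insert_direction i [] = [i]"
| "insert_direction E1 (k # ks) = E1 # k # ks"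
| "insert_direction E2 (E1 # ks) = E1 # insert_direction E2 ks"
| "insert_direction E2 (E2 # ks) = E2 # E2 # ks"
| "insert_direction E2 (E3 # ks) = E2 # E3 # ks"
| "insert_direction E3 (k # ks) = k # insert_direction E3 ks"

fun raise :: "direction \<Rightarrow> jet \<Rightarrow> jet" where
  "raise i (Jet s ks) = Jet s (insert_direction i ks)"

datatype comparison = LT | EQ | GT

text \<open>Jets of high order come first: multiplying by a jet costs as much as the jets that precede it, and the
  factors of the flow that multiply the largest polynomials have the jets of highest order. The last
  argument is the verdict so far, which stands if the lists have the same length.\<close>

fun compare_directions :: "direction list \<Rightarrow> direction list \<Rightarrow> comparison \<Rightarrow> comparison" where
  "compare_directions [] [] z = z"
| "compare_directions [] (y # ys) z = GT"
| "compare_directions (x # xs) [] z = LT"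
| "compare_directions (E1 # xs) (E1 # ys) z = compare_directions xs ys z"
| "compare_directions (E1 # xs) (E2 # ys) z = compare_directions xs ys LT"
| "compare_directions (E1 # xs) (E3 # ys) z = compare_directions xs ys LT"
| "compare_directions (E2 # xs) (E1 # ys) z = compare_directions xs ys GT"
| "compare_directions (E2 # xs) (E2 # ys) z = compare_directions xs ys z"
| "compare_directions (E2 # xs) (E3 # ys) z = compare_directions xs ys LT"
| "compare_directions (E3 # xs) (E1 # ys) z = compare_directions xs ys GT"
| "compare_directions (E3 # xs) (E2 # ys) z = compare_directions xs ys GT"
| "compare_directions (E3 # xs) (E3 # ys) z = compare_directions xs ys z"

fun compare_jets :: "jet \<Rightarrow> jet \<Rightarrow> comparison" where
  "compare_jets (Jet Rho xs) (Jet Rho ys) = compare_directions xs ys EQ"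
| "compare_jets (Jet Rho xs) (Jet Cas ys) = compare_directions xs ys LT"
| "compare_jets (Jet Cas xs) (Jet Cas ys) = compare_directions xs ys EQ"
| "compare_jets (Jet Cas xs) (Jet Rho ys) = compare_directions xs ys GT"

text \<open>Polynomials in Horner form: \<open>Node v p q\<close> stands for \<open>v * p + q\<close>. The operations keep the jets
  increasing along both branches, with \<open>v\<close> allowed to recur in \<open>p\<close> but not in \<open>q\<close>; with that invariant
  the zero polynomial is represented by \<open>Const 0\<close> alone. The correctness lemmas below hold for
  arbitrary terms, so the invariant never has to be proved.\<close>

datatype dpoly = Const real | Node jet dpoly dpoly

primrec ev :: "(jet \<Rightarrow> real) \<Rightarrow> dpoly \<Rightarrow> real" where
  "ev e (Const c) = c"
| "ev e (Node v p q) = e v * ev e p + ev e q"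

fun node :: "jet \<Rightarrow> dpoly \<Rightarrow> dpoly \<Rightarrow> dpoly" where
  "node v (Const c) q = (if c = 0 then q else Node v (Const c) q)"
| "node v (Node u p r) q = Node v (Node u p r) q"

fun add :: "dpoly \<Rightarrow> dpoly \<Rightarrow> dpoly" where
  "add (Const c) (Const d) = Const (c + d)"
| "add (Const c) (Node v r s) = Node v r (add (Const c) s)"
| "add (Node u p q) (Const d) = Node u p (add q (Const d))"
| "add (Node u p q) (Node v r s) = (case compare_jets u v of
     LT \<Rightarrow> Node u p (add q (Node v r s))
   | EQ \<Rightarrow> node u (add p r) (add q s)
   | GT \<Rightarrow> Node v r (add (Node u p q) s))"

fun jet_mul :: "jet \<Rightarrow> dpoly \<Rightarrow> dpoly" where
  "jet_mul v (Const c) = (if c = 0 then Const 0 else Node v (Const c) (Const 0))"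
| "jet_mul v (Node u p q) = (case compare_jets u v of
     LT \<Rightarrow> Node u (jet_mul v p) (jet_mul v q)
   | _ \<Rightarrow> Node v (Node u p q) (Const 0))"

fun scale :: "real \<Rightarrow> dpoly \<Rightarrow> dpoly" where
  "scale c (Const d) = Const (c * d)"
| "scale c (Node v p q) = node v (scale c p) (scale c q)"

fun mul :: "dpoly \<Rightarrow> dpoly \<Rightarrow> dpoly" where
  "mul (Const c) q = (if c = 0 then Const 0 else if c = 1 then q else scale c q)"
| "mul (Node v p r) q = add (jet_mul v (mul p q)) (mul r q)"

fun ddiff :: "direction \<Rightarrow> dpoly \<Rightarrow> dpoly" where
  "ddiff i (Const c) = Const 0"
| "ddiff i (Node v p q) = add (add (jet_mul (raise i v) p) (jet_mul v (ddiff i p))) (ddiff i q)"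

text \<open>A constant of its own, so that rewriting can be kept from entering the summand before its index is
  known.\<close>

definition sum_directions :: "(direction \<Rightarrow> dpoly) \<Rightarrow> dpoly" where
  "sum_directions F = add (F E1) (add (F E2) (F E3))"

lemma compare_directions_EQ: "compare_directions xs ys z = EQ \<Longrightarrow> z = EQ \<and> xs = ys"
  by (induction xs ys z rule: compare_directions.induct) auto

lemma compare_jets_EQ: "compare_jets u v = EQ \<Longrightarrow> u = v"
  by (induction u v rule: compare_jets.induct) (auto dest: compare_directions_EQ)

lemma ev_node [simp]: "ev e (node v p q) = e v * ev e p + ev e q"
  by (cases p) auto

lemma ev_add [simp]: "ev e (add p q) = ev e p + ev e q"
  by (induction p q rule: add.induct)
    (auto simp: algebra_simps dest: compare_jets_EQ split: comparison.split)

lemma ev_jet_mul [simp]: "ev e (jet_mul v p) = e v * ev e p"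
  by (induction p) (auto simp: algebra_simps split: comparison.split)

lemma ev_scale [simp]: "ev e (scale c p) = c * ev e p"
  by (induction p) (auto simp: algebra_simps)

lemma ev_mul [simp]: "ev e (mul p q) = ev e p * ev e q"
  by (induction p) (auto simp: algebra_simps)

lemma ev_sum_directions [simp]:
  "ev e (sum_directions F) = ev e (F E1) + ev e (F E2) + ev e (F E3)"
  by (simp add: sum_directions_def)

text \<open>Introduction rule that matches nested formal sums with nested sums over \<^typ>\<open>3\<close> without
  expanding either.\<close>

lemma ev_sum_directionsI:
  assumes "\<And>i. ev e (F i) = f (index i)"
  shows "ev e (sum_directions F) = (\<Sum>k\<in>UNIV. f k)"
  by (simp add: sum_3 assms)

fun jet_value :: "scalar_field \<Rightarrow> scalar_field \<Rightarrow> jet \<Rightarrow> scalar_field" where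
  "jet_value \<rho> a (Jet Rho ks) = foldr partial (map index ks) \<rho>"
| "jet_value \<rho> a (Jet Cas ks) = foldr partial (map index ks) a"

lemma foldr_partial_insert_direction:
  assumes "smooth f"
  shows "foldr partial (map index (insert_direction i ks)) f
    = partial (index i) (foldr partial (map index ks) f)"
  using assms
  by (induction i ks rule: insert_direction.induct)
    (auto simp: partial_commute smooth_foldr_partial simp del: index.simps)

locale smooth_pair =
  fixes \<rho> a :: scalar_field
  assumes smooth_rho: "smooth \<rho>" and smooth_cas: "smooth a"
begin

definition val :: "dpoly \<Rightarrow> scalar_field" where
  "val p = (\<lambda>x. ev (\<lambda>v. jet_value \<rho> a v x) p)"

lemma smooth_jet_value: "smooth (jet_value \<rho> a v)"
  using smooth_rho smooth_cas
  by (cases "(\<rho>, a, v)" rule: jet_value.cases) (auto intro: smooth_foldr_partial)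

lemma jet_value_raise: "jet_value \<rho> a (raise i v) = partial (index i) (jet_value \<rho> a v)"
  using smooth_rho smooth_cas
  by (cases "(\<rho>, a, v)" rule: jet_value.cases) (auto simp: foldr_partial_insert_direction)

lemma val_differentiable: "val p differentiable at x"
  unfolding val_def
  by (induction p)
    (auto intro!: differentiable_add differentiable_mult smooth_differentiable[OF smooth_jet_value])

lemma val_Node: "val (Node v p q) = (\<lambda>x. jet_value \<rho> a v x * val p x + val q x)"
  by (simp add: val_def)

lemma partial_val: "partial (index i) (val p) = val (ddiff i p)"
proof (induction p)
  case (Const c)
  show ?case by (simp add: val_def)
next
  case (Node v p q)
  have d: "jet_value \<rho> a v differentiable at x" "val p differentiable at x" "val q differentiable at x" for x
    by (auto intro: val_differentiable smooth_differentiable smooth_jet_value)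
  have "partial (index i) (val (Node v p q)) x = val (ddiff i (Node v p q)) x" for x
    unfolding val_Node using d[of x] Node.IH
    by (simp add: partial_add partial_mult differentiable_mult) (simp add: val_def jet_value_raise algebra_simps)
  then show ?case ..
qed

end

section \<open>The Nambu bi-vector and its tetrahedral flow\<close>

fun epsilon :: "direction \<Rightarrow> direction \<Rightarrow> direction \<Rightarrow> real" where
  "epsilon E1 E2 E3 = 1"
| "epsilon E2 E3 E1 = 1"
| "epsilon E3 E1 E2 = 1"
| "epsilon E1 E3 E2 = - 1"
| "epsilon E3 E2 E1 = - 1"
| "epsilon E2 E1 E3 = - 1"
| "epsilon _ _ _ = 0"

lemma levi_civita_index: "levi_civita (index i) (index j) (index k) = epsilon i j k"
  by (cases i; cases j; cases k) (simp_all add: levi_civita_def)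

lemma levi_civita_swap: "levi_civita i k j = - levi_civita i j k"
proof -
  obtain i' j' k' where eqs: "i = index i'" "j = index j'" "k = index k'" by (metis index_cases)
  have "epsilon i' k' j' = - epsilon i' j' k'"
    by (cases i'; cases j'; cases k') simp_all
  then show ?thesis by (simp only: eqs levi_civita_index)
qed

lemma ev_mulI: "ev e p = s \<Longrightarrow> ev e q = t \<Longrightarrow> ev e (mul p q) = s * t"
  by simp

definition nambu_dpoly :: "direction \<Rightarrow> direction \<Rightarrow> dpoly" where
  "nambu_dpoly j k = sum_directions (\<lambda>i. scale (epsilon i j k) (jet_mul rho (jet_mul (raise i cas) (Const 1))))"

text \<open>The first two sums of the tetrahedral flow. The nesting keeps the order of the summation indices but
  pulls each factor out of the sums on which it does not depend, which replaces 729 products by a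
  Horner-like scheme.\<close>

definition flow_term1 :: "direction \<Rightarrow> direction \<Rightarrow> dpoly" where
  "flow_term1 i j = sum_directions (\<lambda>a. sum_directions (\<lambda>b. sum_directions (\<lambda>c.
     mul (ddiff a (ddiff b (ddiff c (nambu_dpoly i j))))
       (sum_directions (\<lambda>p. sum_directions (\<lambda>q. mul (ddiff p (nambu_dpoly b q))
         (sum_directions (\<lambda>r. mul (ddiff r (nambu_dpoly a p)) (ddiff q (nambu_dpoly c r))))))))))"

definition flow_term2 :: "direction \<Rightarrow> direction \<Rightarrow> dpoly" where
  "flow_term2 i j = sum_directions (\<lambda>a. sum_directions (\<lambda>b. sum_directions (\<lambda>c.
     mul (ddiff b (ddiff c (nambu_dpoly i a)))
       (sum_directions (\<lambda>d. sum_directions (\<lambda>e. mul (ddiff d (nambu_dpoly b e))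
         (sum_directions (\<lambda>r. mul (ddiff e (nambu_dpoly c r)) (ddiff a (ddiff r (nambu_dpoly j d)))))))))))"

definition flow_dpoly :: "direction \<Rightarrow> direction \<Rightarrow> dpoly" where
  "flow_dpoly i j = add (flow_term1 i j)
     (scale (- 3) (add (flow_term2 i j) (scale (- 1) (flow_term2 j i))))"

text \<open>The relabelling of summation indices that identifies the graphs of the second and the third sum.\<close>

lemma sum_reorder6:
  fixes F :: "'a \<Rightarrow> 'a \<Rightarrow> 'a \<Rightarrow> 'a \<Rightarrow> 'a \<Rightarrow> 'a \<Rightarrow> real"
  shows "(\<Sum>a\<in>S. \<Sum>b\<in>S. \<Sum>c\<in>S. \<Sum>s\<in>S. \<Sum>t\<in>S. \<Sum>u\<in>S. F s b u a c t)
    = (\<Sum>a\<in>S. \<Sum>b\<in>S. \<Sum>c\<in>S. \<Sum>d\<in>S. \<Sum>e\<in>S. \<Sum>r\<in>S. F a b c d e r)"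
  unfolding sum.cartesian_product
  by (rule sum.reindex_bij_witness[
        where i = "\<lambda>(a, b, c, d, e, r). (d, b, e, a, r, c)" and j = "\<lambda>(a, b, c, s, t, u). (s, b, u, a, c, t)"])
    auto

context smooth_pair
begin

abbreviation "P \<equiv> nambu \<rho> a"

lemma nambu_index: "P (index j) (index k) = val (nambu_dpoly j k)"
  by (simp add: fun_eq_iff nambu_def val_def nambu_dpoly_def sum_3 flip: levi_civita_index)

lemma nambu_swap: "P k j = (\<lambda>x. - P j k x)"
  by (simp add: nambu_def levi_civita_swap[of _ k j] sum_negf)

lemma partial_nambu_swap:
  "partial i (P k j) x = - partial i (P j k) x"
  "partial i (partial l (partial m (P k j))) x = - partial i (partial l (partial m (P j k))) x"
proof -
  have minus_val: "partial n (\<lambda>x. - val p x) = (\<lambda>x. - partial n (val p) x)" for n p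
    by (simp add: fun_eq_iff partial_minus val_differentiable)
  obtain j' k' l' m' where eqs: "j = index j'" "k = index k'" "l = index l'" "m = index m'"
    by (metis index_cases)
  show "partial i (P k j) x = - partial i (P j k) x"
    "partial i (partial l (partial m (P k j))) x = - partial i (partial l (partial m (P j k))) x"
    unfolding nambu_swap[of k j] by (simp_all add: eqs nambu_index partial_val minus_val)
qed

lemma val_flow_term1:
  "val (flow_term1 i j) x =
     (\<Sum>a\<in>UNIV. \<Sum>b\<in>UNIV. \<Sum>c\<in>UNIV. \<Sum>p\<in>UNIV. \<Sum>q\<in>UNIV. \<Sum>r\<in>UNIV.
        partial a (partial b (partial c (P (index i) (index j)))) x * partial r (P a p) x
          * partial p (P b q) x * partial q (P c r) x)"
proof -
  have "val (flow_term1 i j) x =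
     (\<Sum>a\<in>UNIV. \<Sum>b\<in>UNIV. \<Sum>c\<in>UNIV. partial a (partial b (partial c (P (index i) (index j)))) x *
       (\<Sum>p\<in>UNIV. \<Sum>q\<in>UNIV. partial p (P b q) x * (\<Sum>r\<in>UNIV. partial r (P a p) x * partial q (P c r) x)))"
    unfolding val_def flow_term1_def
    by (intro ev_sum_directionsI ev_mulI) (simp_all only: nambu_index partial_val fun_cong[OF val_def])
  then show ?thesis
    by (simp only: sum_distrib_left mult_ac)
qed

lemma val_flow_term2:
  "val (flow_term2 i j) x =
     (\<Sum>a\<in>UNIV. \<Sum>b\<in>UNIV. \<Sum>c\<in>UNIV. \<Sum>d\<in>UNIV. \<Sum>e\<in>UNIV. \<Sum>r\<in>UNIV.
        partial b (partial c (P (index i) a)) x * partial a (partial r (P (index j) d)) x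
          * partial d (P b e) x * partial e (P c r) x)"
proof -
  have "val (flow_term2 i j) x =
     (\<Sum>a\<in>UNIV. \<Sum>b\<in>UNIV. \<Sum>c\<in>UNIV. partial b (partial c (P (index i) a)) x *
       (\<Sum>d\<in>UNIV. \<Sum>e\<in>UNIV. partial d (P b e) x *
         (\<Sum>r\<in>UNIV. partial e (P c r) x * partial a (partial r (P (index j) d)) x)))"
    unfolding val_def flow_term2_def
    by (intro ev_sum_directionsI ev_mulI) (simp_all only: nambu_index partial_val fun_cong[OF val_def])
  then show ?thesis
    by (simp only: sum_distrib_left mult_ac)
qed

text \<open>The third sum of the tetrahedral flow contracts the same graph as the second one, with the roles of
  \<open>i\<close> and \<open>j\<close> interchanged and the two edges of one vertex swapped; the swap is the sign.\<close>

lemma val_flow_term3: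
  "- val (flow_term2 j i) x =
     (\<Sum>a\<in>UNIV. \<Sum>b\<in>UNIV. \<Sum>c\<in>UNIV. \<Sum>s\<in>UNIV. \<Sum>t\<in>UNIV. \<Sum>u\<in>UNIV.
        partial s (partial t (P (index i) a)) x * partial a (P b c) x
          * partial b (partial u (P (index j) s)) x * partial c (P t u) x)"
proof -
  define F where "F a b c d e r = partial b (partial c (P (index j) a)) x * partial a (partial r (P (index i) d)) x
          * partial d (P b e) x * partial e (P c r) x" for a b c d e r
  have "partial s (partial t (P (index i) a)) x * partial a (P b c) x
          * partial b (partial u (P (index j) s)) x * partial c (P t u) x = - F s b u a c t" for a b c s t u
    by (simp add: F_def partial_nambu_swap(1)[of c u t])
  then show ?thesis
    unfolding val_flow_term2 F_def[symmetric] by (simp only: sum_negf sum_reorder6[of F])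
qed

lemma tetra_flow_index: "tetra_flow P (index i) (index j) x = val (flow_dpoly i j) x"
proof -
  have "val (flow_dpoly i j) x = val (flow_term1 i j) x - 3 * (val (flow_term2 i j) x + - val (flow_term2 j i) x)"
    by (simp add: val_def flow_dpoly_def)
  then show ?thesis
    unfolding tetra_flow_def val_flow_term3[symmetric] val_flow_term1[symmetric] val_flow_term2[symmetric] by (rule sym)
qed

lemma tetra_flow_swap: "tetra_flow P k j x = - tetra_flow P j k x"
proof -
  obtain j' k' where jk: "j = index j'" "k = index k'" by (metis index_cases)
  have "val (flow_term1 k' j') x = - val (flow_term1 j' k') x"
    unfolding val_flow_term1 partial_nambu_swap(2)[of _ _ _ "index k'" "index j'"] by (simp add: sum_negf)
  then show ?thesis
    unfolding jk tetra_flow_index by (simp add: val_def flow_dpoly_def)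
qed

end

section \<open>Vector fields encoded by micro-graphs\<close>

definition inner_vertices :: "micrograph \<Rightarrow> nat list" where
  "inner_vertices G = filter (\<lambda>v. v \<noteq> sink G) [0, 1, 2, 3, 4, 5, 6]"

text \<open>Separated from the labellings, so that the edge positions are computed once per graph and not once per
  labelling.\<close>

definition layout :: "micrograph \<Rightarrow> (nat list \<times> nat list) list" where
  "layout G = map (\<lambda>v. (out_edges G v, in_edges G v)) (inner_vertices G)"

definition sink_edge :: "micrograph \<Rightarrow> nat" where
  "sink_edge G = hd (in_edges G (sink G))"

text \<open>The nine edges are labelled by a list of nine directions.\<close>

fun raise_along :: "direction list \<Rightarrow> nat list \<Rightarrow> jet \<Rightarrow> jet" where
  "raise_along xs [] v = v"
| "raise_along xs (n # ns) v = raise (xs ! n) (raise_along xs ns v)"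

text \<open>The contribution of one labelling. The sign is accumulated in the coefficient, so that the result is a
  single chain of jets.\<close>

fun monomial :: "(nat list \<times> nat list) list \<Rightarrow> direction list \<Rightarrow> real \<Rightarrow> dpoly" where
  "monomial [] xs c = Const c"
| "monomial (([], ins) # L) xs c = jet_mul (raise_along xs ins cas) (monomial L xs c)"
| "monomial (([i, j, k], ins) # L) xs c =
    jet_mul (raise_along xs ins rho) (monomial L xs (c * epsilon (xs ! i) (xs ! j) (xs ! k)))"

definition permutations3 :: "direction list list" where
  "permutations3 = [[E1, E2, E3], [E2, E3, E1], [E3, E1, E2], [E1, E3, E2], [E3, E2, E1], [E2, E1, E3]]"

definition labellings :: "direction list list" where
  "labellings = map (\<lambda>(p, q, r). p @ q @ r)
     (List.product permutations3 (List.product permutations3 permutations3))"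

text \<open>The lists over which these functions recurse are arguments rather than constants in a formal sum: in
  this form each rewriting step is a first-order match on data.\<close>

fun component_sum ::
  "direction list list \<Rightarrow> (nat list \<times> nat list) list \<Rightarrow> nat \<Rightarrow> direction \<Rightarrow> real \<Rightarrow> dpoly" where
  "component_sum [] L n k c = Const 0"
| "component_sum (xs # xss) L n k c =
    (if xs ! n = k then add (monomial L xs c) (component_sum xss L n k c) else component_sum xss L n k c)"

fun field_component :: "direction list list \<Rightarrow> (real \<times> micrograph) list \<Rightarrow> direction \<Rightarrow> dpoly" where
  "field_component xss [] k = Const 0"
| "field_component xss ((c, G) # L) k =
    add (component_sum xss (layout G) (sink_edge G) k c) (field_component xss L k)"

text \<open>All that the reduction to \<^const>\<open>labellings\<close> uses of a graph.\<close>

definition trident_micrograph :: "micrograph \<Rightarrow> bool" where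
  "trident_micrograph G \<longleftrightarrow>
     length (edges G) = 9 \<and> sink G < 7 \<and> in_edges G (sink G) = [sink_edge G] \<and>
     list_all (\<lambda>v. out_edges G v = [] \<or> length (out_edges G v) = 3) (inner_vertices G) \<and>
     {[0, 1, 2], [3, 4, 5], [6, 7, 8]} \<subseteq> set (map (out_edges G) (inner_vertices G))"

lemma trident_micrographs_X_tetra: "\<forall>(c, G) \<in> set X_tetra. trident_micrograph G"
  unfolding X_tetra_def trident_micrograph_def by code_simp

lemma set_permutations3: "[i, j, k] \<in> set permutations3 \<longleftrightarrow> epsilon i j k \<noteq> 0"
  by (cases i; cases j; cases k) (simp_all add: permutations3_def)

lemma set_labellings:
  "xs \<in> set labellings \<longleftrightarrow> length xs = 9 \<and> epsilon (xs ! 0) (xs ! 1) (xs ! 2) \<noteq> 0 \<and>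
     epsilon (xs ! 3) (xs ! 4) (xs ! 5) \<noteq> 0 \<and> epsilon (xs ! 6) (xs ! 7) (xs ! 8) \<noteq> 0" (is "?L \<longleftrightarrow> ?R")
proof
  have perm: "\<exists>i j k. p = [i, j, k] \<and> epsilon i j k \<noteq> 0" if "p \<in> set permutations3" for p
    using that by (auto simp: permutations3_def)
  assume ?L
  then obtain p q r where "xs = p @ q @ r" "p \<in> set permutations3" "q \<in> set permutations3" "r \<in> set permutations3"
    by (auto simp: labellings_def)
  with perm[of p] perm[of q] perm[of r] show ?R by auto
next
  assume R: ?R
  then obtain x0 x1 x2 x3 x4 x5 x6 x7 x8 where xs: "xs = [x0, x1, x2] @ [x3, x4, x5] @ [x6, x7, x8]"
    by (auto simp: length_Suc_conv numeral_eq_Suc)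
  with R have "[x0, x1, x2] \<in> set permutations3" "[x3, x4, x5] \<in> set permutations3"
    "[x6, x7, x8] \<in> set permutations3"
    by (simp_all add: set_permutations3)
  then show ?L
    unfolding xs labellings_def set_map set_product
    by (intro image_eqI[where x = "([x0, x1, x2], [x3, x4, x5], [x6, x7, x8])"]) simp_all
qed

lemma distinct_labellings: "distinct labellings"
proof -
  have len: "length p = 3" if "p \<in> set permutations3" for p
    using that by (auto simp: permutations3_def)
  have "inj_on (\<lambda>(p, q, r). p @ q @ r) (set permutations3 \<times> set permutations3 \<times> set permutations3)"
    by (auto simp: inj_on_def len)
  moreover have "distinct permutations3"
    by (simp add: permutations3_def)
  ultimately show ?thesis
    by (simp add: labellings_def distinct_map distinct_product)
qed

definition label :: "direction list \<Rightarrow> nat \<Rightarrow> 3" where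
  "label xs = (\<lambda>n\<in>{0..<9}. index (xs ! n))"

lemma label_nth: "n < 9 \<Longrightarrow> label xs n = index (xs ! n)"
  by (simp add: label_def)

lemma bij_betw_label: "bij_betw label {xs. length xs = 9} ({0..<9} \<rightarrow>\<^sub>E UNIV)"
proof (rule bij_betwI[where g = "\<lambda>\<iota>. map (\<lambda>n. THE i. index i = \<iota> n) [0..<9]"])
  show "label \<in> {xs. length xs = 9} \<rightarrow> {0..<9} \<rightarrow>\<^sub>E UNIV"
    by (auto simp: label_def)
  show "map (\<lambda>n. THE i. index i = label xs n) [0..<9] = xs" if "xs \<in> {xs. length xs = 9}" for xs
    using that by (intro nth_equalityI) (auto simp: label_nth)
  show "label (map (\<lambda>n. THE i. index i = \<iota> n) [0..<9]) = \<iota>" if "\<iota> \<in> {0..<9} \<rightarrow>\<^sub>E UNIV" for \<iota>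
  proof
    fix n
    obtain i where i: "\<iota> n = index i" by (metis index_cases)
    then have "(THE i. index i = \<iota> n) = i" by auto
    with that i show "label (map (\<lambda>n. THE i. index i = \<iota> n) [0..<9]) n = \<iota> n"
      by (auto simp: label_def PiE_def extensional_def)
  qed
qed auto

lemma set_inner_vertices: "set (inner_vertices G) = {0..<7} - {sink G}"
proof -
  have "v \<in> {0..<7} \<longleftrightarrow> v \<in> set [0, 1, 2, 3, 4, 5, 6]" for v :: nat
    by (simp, presburger)
  then show ?thesis unfolding inner_vertices_def set_filter by blast
qed

lemma in_edges_less: "n \<in> set (in_edges G v) \<Longrightarrow> n < length (edges G)"
  by (simp add: in_edges_def)

lemma out_edges_less: "n \<in> set (out_edges G v) \<Longrightarrow> n < length (edges G)"
  by (simp add: out_edges_def)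

context smooth_pair
begin

definition vertex_factor :: "micrograph \<Rightarrow> scalar_field \<Rightarrow> (nat \<Rightarrow> 3) \<Rightarrow> nat \<Rightarrow> scalar_field" where
  "vertex_factor G f \<iota> v = foldr partial (map \<iota> (in_edges G v)) (vertex_content G \<rho> a f \<iota> v)"

text \<open>The Levi-Civita symbol in the content of a trident is constant and passes through derivatives.\<close>

lemma foldr_partial_scaled:
  assumes "smooth h"
  shows "foldr partial ks (\<lambda>x. h x * c) = (\<lambda>x. foldr partial ks h x * c)"
proof (induction ks)
  case (Cons k ks)
  have "foldr partial ks h differentiable at x" for x
    using assms by (intro smooth_differentiable smooth_foldr_partial)
  then show ?case
    by (simp add: Cons.IH fun_eq_iff partial_mult)
qed simp

lemma foldr_partial_label:
  assumes "\<And>n. n \<in> set ns \<Longrightarrow> n < 9"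
  shows "foldr partial (map (label xs) ns) (jet_value \<rho> a v) = jet_value \<rho> a (raise_along xs ns v)"
  using assms by (induction ns) (auto simp: label_nth jet_value_raise)

lemma vertex_factor_terminal:
  assumes "length (edges G) = 9" "v \<noteq> sink G" "out_edges G v = []"
  shows "vertex_factor G f (label xs) v x = jet_value \<rho> a (raise_along xs (in_edges G v) cas) x"
  using assms foldr_partial_label[of "in_edges G v" xs cas] in_edges_less[of _ G v]
  by (simp add: vertex_factor_def vertex_content_def)

lemma vertex_factor_trident:
  assumes "length (edges G) = 9" "v \<noteq> sink G" "out_edges G v = [i, j, k]"
  shows "vertex_factor G f (label xs) v x =
    jet_value \<rho> a (raise_along xs (in_edges G v) rho) x * epsilon (xs ! i) (xs ! j) (xs ! k)"
proof -
  have "i < 9" "j < 9" "k < 9"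
    using assms out_edges_less[of _ G v] by auto
  then show ?thesis
    using assms foldr_partial_label[of "in_edges G v" xs rho] in_edges_less[of _ G v]
    by (simp add: vertex_factor_def vertex_content_def foldr_partial_scaled smooth_rho label_nth levi_civita_index)
qed

lemma val_monomial:
  assumes "length (edges G) = 9"
    and "\<And>v. v \<in> set vs \<Longrightarrow> v \<noteq> sink G \<and> (out_edges G v = [] \<or> length (out_edges G v) = 3)"
  shows "val (monomial (map (\<lambda>v. (out_edges G v, in_edges G v)) vs) xs c) x
    = c * (\<Prod>v\<leftarrow>vs. vertex_factor G f (label xs) v x)"
  using assms(2)
proof (induction vs arbitrary: c)
  case Nil
  show ?case by (simp add: val_def)
next
  case (Cons v vs)
  consider "out_edges G v = []" | i j k where "out_edges G v = [i, j, k]"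
    using Cons.prems[of v] by (auto simp: length_Suc_conv numeral_3_eq_3)
  then show ?case
  proof cases
    case 1
    with Cons vertex_factor_terminal[OF assms(1), of v f xs x] show ?thesis
      by (simp add: val_def)
  next
    case 2
    with Cons vertex_factor_trident[OF assms(1), of v i j k f xs x] show ?thesis
      by (simp add: val_def)
  qed
qed

lemma vertex_product:
  assumes "trident_micrograph G"
  shows "(\<Prod>v\<in>{0..<7}. vertex_factor G f (label xs) v x)
    = val (monomial (layout G) xs 1) x * partial (index (xs ! sink_edge G)) f x"
proof -
  let ?F = "\<lambda>v. vertex_factor G f (label xs) v x"
  have G: "length (edges G) = 9" "sink G < 7" "in_edges G (sink G) = [sink_edge G]"
    using assms by (auto simp: trident_micrograph_def)
  have inner: "set (inner_vertices G) = {0..<7} - {sink G}" "distinct (inner_vertices G)"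
    by (simp_all add: set_inner_vertices) (simp add: inner_vertices_def)
  have "sink_edge G < 9"
    using in_edges_less[of "sink_edge G" G "sink G"] G by simp
  then have "?F (sink G) = partial (index (xs ! sink_edge G)) f x"
    by (simp add: vertex_factor_def vertex_content_def G label_nth)
  moreover have "(\<Prod>v\<in>{0..<7}. ?F v) = ?F (sink G) * (\<Prod>v\<in>{0..<7} - {sink G}. ?F v)"
    using G by (intro prod.remove) auto
  moreover have "(\<Prod>v\<in>{0..<7} - {sink G}. ?F v) = (\<Prod>v\<leftarrow>inner_vertices G. ?F v)"
    using inner by (simp add: prod.distinct_set_conv_list flip: inner(1))
  moreover have "val (monomial (layout G) xs 1) x = 1 * (\<Prod>v\<leftarrow>inner_vertices G. ?F v)"
    unfolding layout_def using assms inner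
    by (intro val_monomial G) (auto simp: trident_micrograph_def list_all_iff)
  ultimately show ?thesis by simp
qed

lemma vertex_product_zero:
  assumes "trident_micrograph G" "length xs = 9" "xs \<notin> set labellings"
  shows "(\<Prod>v\<in>{0..<7}. vertex_factor G f (label xs) v x) = 0"
proof -
  have "\<exists>i j k. [i, j, k] \<in> set (map (out_edges G) (inner_vertices G)) \<and> epsilon (xs ! i) (xs ! j) (xs ! k) = 0"
  proof -
    have "\<exists>i j k. [i, j, k] \<in> {[0, 1, 2], [3, 4, 5], [6, 7, 8]} \<and> epsilon (xs ! i) (xs ! j) (xs ! k) = 0"
      using assms(2,3) unfolding set_labellings by blast
    with assms(1) show ?thesis
      unfolding trident_micrograph_def by blast
  qed
  then obtain v i j k where v: "v \<in> set (inner_vertices G)" "out_edges G v = [i, j, k]"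
    and "epsilon (xs ! i) (xs ! j) (xs ! k) = 0"
    by (metis (no_types, lifting) imageE set_map)
  then have "vertex_factor G f (label xs) v x = 0"
    using assms(1) by (subst vertex_factor_trident) (auto simp: trident_micrograph_def set_inner_vertices)
  then show ?thesis
    using v(1) by (intro prod_zero) (auto simp: set_inner_vertices)
qed

text \<open>Labellings outside \<^const>\<open>labellings\<close> drop out, because one of the tridents contributes the factor
  zero.\<close>

lemma graph_field_labellings:
  assumes "trident_micrograph G"
  shows "graph_field G \<rho> a f x
    = (\<Sum>xs\<leftarrow>labellings. val (monomial (layout G) xs 1) x * partial (index (xs ! sink_edge G)) f x)"
proof -
  let ?F = "\<lambda>\<iota>. \<Prod>v\<in>{0..<7}. vertex_factor G f \<iota> v x"
  have "length (edges G) = 9"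
    using assms by (simp add: trident_micrograph_def)
  then have "graph_field G \<rho> a f x = (\<Sum>\<iota>\<in>{0..<9} \<rightarrow>\<^sub>E UNIV. ?F \<iota>)"
    by (simp add: graph_field_def vertex_factor_def)
  also have "\<dots> = (\<Sum>xs | length xs = 9. ?F (label xs))"
    using sum.reindex_bij_betw[OF bij_betw_label, of ?F] by simp
  also have "\<dots> = (\<Sum>xs\<in>set labellings. ?F (label xs))"
  proof (rule sum.mono_neutral_right)
    have "finite ({0..<9::nat} \<rightarrow>\<^sub>E (UNIV :: 3 set))"
      by (intro finite_PiE) auto
    then show "finite {xs :: direction list. length xs = 9}"
      using bij_betw_finite[OF bij_betw_label] by blast
    show "\<forall>xs\<in>{xs. length xs = 9} - set labellings. ?F (label xs) = 0"
      using vertex_product_zero[OF assms] by blast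
  qed (auto simp: set_labellings)
  also have "\<dots> = (\<Sum>xs\<leftarrow>labellings. ?F (label xs))"
    by (simp add: sum.distinct_set_conv_list distinct_labellings)
  finally show ?thesis
    by (simp add: vertex_product[OF assms])
qed

lemma val_component_sum:
  assumes "trident_micrograph G" 
  shows "val (component_sum xss (layout G) n k c) x
    = c * (\<Sum>xs\<leftarrow>xss. if xs ! n = k then val (monomial (layout G) xs 1) x else 0)"
proof (induction xss)
  case Nil
  show ?case by (simp add: val_def)
next
  case (Cons xs xss)
  have "val (monomial (layout G) xs c) x = c * val (monomial (layout G) xs 1) x"
    unfolding layout_def using assms
    by (subst (1 2) val_monomial) (auto simp: trident_micrograph_def list_all_iff set_inner_vertices)
  with Cons show ?case
    by (simp add: val_def algebra_simps)
qed

lemma graph_field_components: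
  assumes "trident_micrograph G"
  shows "c * graph_field G \<rho> a f x
    = (\<Sum>k\<in>{E1, E2, E3}. val (component_sum labellings (layout G) (sink_edge G) k c) x * partial (index k) f x)"
proof -
  have "(\<Sum>xs\<leftarrow>xss. w xs * partial (index (xs ! n)) f x)
    = (\<Sum>k\<in>{E1, E2, E3}. (\<Sum>xs\<leftarrow>xss. if xs ! n = k then w xs else 0) * partial (index k) f x)" for w xss n
  proof (induction xss)
    case (Cons xs xss)
    then show ?case
      by (cases "xs ! n") (simp_all add: algebra_simps del: index.simps)
  qed simp
  then show ?thesis
    unfolding graph_field_labellings[OF assms] val_component_sum[OF assms]
    by (simp only: sum_distrib_left mult.assoc)
qed

lemma encoded_field_components:
  assumes "\<forall>(c, G) \<in> set L. trident_micrograph G"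
  shows "encoded_field L \<rho> a f x
    = (\<Sum>k\<in>{E1, E2, E3}. val (field_component labellings L k) x * partial (index k) f x)"
  using assms
proof (induction L)
  case Nil
  show ?case by (simp add: encoded_field_def val_def)
next
  case (Cons cG L)
  obtain c G where "cG = (c, G)" by fastforce
  with Cons graph_field_components[of G c f x] show ?case
    by (simp add: encoded_field_def val_def algebra_simps del: index.simps)
qed

end

section \<open>The Schouten bracket in components\<close>

text \<open>The algebra of the Schouten bracket at one point: \<open>u\<close>, \<open>v\<close> are the gradients of \<open>f\<close>, \<open>g\<close> and \<open>u2\<close>,
  \<open>v2\<close> their Hessians, whose symmetry makes them cancel.\<close>

lemma bracket_sum:
  fixes p y u v :: "_ \<Rightarrow> _" and dp :: "3 \<Rightarrow> 3 \<Rightarrow> 3 \<Rightarrow> real"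
  assumes u2: "\<And>i k. u2 k i = u2 i k" and v2: "\<And>i k. v2 k i = v2 i k"
  shows "- (\<Sum>k\<in>UNIV. y k * (\<Sum>i\<in>UNIV. \<Sum>j\<in>UNIV. dp k i j * u i * v j + p i j * u2 k i * v j + p i j * u i * v2 k j))
    + (\<Sum>i\<in>UNIV. \<Sum>j\<in>UNIV. p i j * (\<Sum>k\<in>UNIV. dy i k * u k + y k * u2 i k) * v j)
    + (\<Sum>i\<in>UNIV. \<Sum>j\<in>UNIV. p i j * u i * (\<Sum>k\<in>UNIV. dy j k * v k + y k * v2 j k))
    = (\<Sum>i\<in>UNIV. \<Sum>j\<in>UNIV. (\<Sum>k\<in>UNIV. - (y k * dp k i j) + (p k j * dy k i + p i k * dy k j)) * u i * v j)"
proof -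
  have "u2 2 1 = u2 1 2" "u2 3 1 = u2 1 3" "u2 3 2 = u2 2 3"
    "v2 2 1 = v2 1 2" "v2 3 1 = v2 1 3" "v2 3 2 = v2 2 3"
    using u2 v2 by auto
  then show ?thesis by (simp add: sum_3 algebra_simps)
qed

lemma schouten_components:
  fixes P :: bivector and Y :: "3 \<Rightarrow> scalar_field"
  assumes X: "\<And>h y. X h y = (\<Sum>k\<in>UNIV. Y k y * partial k h y)"
    and P: "\<And>i j y. P i j differentiable at y" and Y: "\<And>k y. Y k differentiable at y"
    and f: "smooth f" and g: "smooth g"
  shows "schouten P X f g x = (\<Sum>i\<in>UNIV. \<Sum>j\<in>UNIV.
    (\<Sum>k\<in>UNIV. - (Y k x * partial k (P i j) x) + (P k j x * partial k (Y i) x + P i k x * partial k (Y j) x))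
      * partial i f x * partial j g x)"
proof -
  have d: "partial k h differentiable at x" if "smooth h" for k h
    using that by (intro smooth_differentiable smooth_partial)
  note diff = differentiable_mult differentiable_add differentiable_sum P Y d[OF f] d[OF g]
  have "partial k (bivector_apply P f g) x = (\<Sum>i\<in>UNIV. \<Sum>j\<in>UNIV. partial k (P i j) x * partial i f x * partial j g x
      + P i j x * partial k (partial i f) x * partial j g x + P i j x * partial i f x * partial k (partial j g) x)" for k
    unfolding bivector_apply_def
    by (simp add: partial_sum partial_mult diff algebra_simps)
  moreover have "partial i (X h) x = (\<Sum>k\<in>UNIV. partial i (Y k) x * partial k h x + Y k x * partial i (partial k h) x)"
    if "smooth h" for i h
  proof -
    have "X h = (\<lambda>y. \<Sum>k\<in>UNIV. Y k y * partial k h y)"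
      using X by blast
    then show ?thesis
      by (simp add: partial_sum partial_mult diff d[OF that])
  qed
  ultimately have "schouten P X f g x =
    - (\<Sum>k\<in>UNIV. Y k x * (\<Sum>i\<in>UNIV. \<Sum>j\<in>UNIV. partial k (P i j) x * partial i f x * partial j g x
        + P i j x * partial k (partial i f) x * partial j g x + P i j x * partial i f x * partial k (partial j g) x))
    + (\<Sum>i\<in>UNIV. \<Sum>j\<in>UNIV. P i j x *
        (\<Sum>k\<in>UNIV. partial i (Y k) x * partial k f x + Y k x * partial i (partial k f) x) * partial j g x)
    + (\<Sum>i\<in>UNIV. \<Sum>j\<in>UNIV. P i j x * partial i f x *
        (\<Sum>k\<in>UNIV. partial j (Y k) x * partial k g x + Y k x * partial j (partial k g) x))"
    unfolding schouten_def using f g by (simp add: X bivector_apply_def)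
  also have "\<dots> = (\<Sum>i\<in>UNIV. \<Sum>j\<in>UNIV.
    (\<Sum>k\<in>UNIV. - (Y k x * partial k (P i j) x) + (P k j x * partial k (Y i) x + P i k x * partial k (Y j) x))
      * partial i f x * partial j g x)"
    by (rule bracket_sum) (simp_all add: partial_commute f g)
  finally show ?thesis .
qed

section \<open>Expansion and comparison\<close>

text \<open>The three coefficients of the vector field travel as one argument, so that they are expanded once and
  then shared by all occurrences in the bracket.\<close>

fun select :: "dpoly \<times> dpoly \<times> dpoly \<Rightarrow> direction \<Rightarrow> dpoly" where
  "select (p, q, r) E1 = p" | "select (p, q, r) E2 = q" | "select (p, q, r) E3 = r"

definition bracket_dpoly :: "dpoly \<times> dpoly \<times> dpoly \<Rightarrow> direction \<Rightarrow> direction \<Rightarrow> dpoly" where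
  "bracket_dpoly Y i j = sum_directions (\<lambda>k.
     add (scale (- 1) (mul (ddiff k (nambu_dpoly i j)) (select Y k)))
       (add (mul (nambu_dpoly k j) (ddiff k (select Y i))) (mul (nambu_dpoly i k) (ddiff k (select Y j)))))"

definition defect :: "dpoly \<times> dpoly \<times> dpoly \<Rightarrow> direction \<Rightarrow> direction \<Rightarrow> dpoly" where
  "defect Y i j = add (bracket_dpoly Y i j) (scale (- 8) (flow_dpoly i j))"

definition defects :: "dpoly \<times> dpoly \<times> dpoly \<Rightarrow> dpoly list" where
  "defects Y = [defect Y E1 E2, defect Y E2 E3, defect Y E3 E1]"

definition X_component :: "direction \<Rightarrow> dpoly" where
  "X_component k = field_component labellings X_tetra k"

definition X_components :: "dpoly \<times> dpoly \<times> dpoly" where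
  "X_components = (X_component E1, X_component E2, X_component E3)"

text \<open>Case distinctions on a comparison as function symbols. Rewriting with one equation per outcome avoids
  the abstractions of a case expression, which dominate the cost of the expansion otherwise.\<close>

definition add_by :: "comparison \<Rightarrow> jet \<Rightarrow> dpoly \<Rightarrow> dpoly \<Rightarrow> jet \<Rightarrow> dpoly \<Rightarrow> dpoly \<Rightarrow> dpoly" where
  "add_by z u p q v r s = (case z of
     LT \<Rightarrow> Node u p (add q (Node v r s))
   | EQ \<Rightarrow> node u (add p r) (add q s)
   | GT \<Rightarrow> Node v r (add (Node u p q) s))"

definition jet_mul_by :: "comparison \<Rightarrow> jet \<Rightarrow> jet \<Rightarrow> dpoly \<Rightarrow> dpoly \<Rightarrow> dpoly" where
  "jet_mul_by z v u p q = (case z of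
     LT \<Rightarrow> Node u (jet_mul v p) (jet_mul v q)
   | _ \<Rightarrow> Node v (Node u p q) (Const 0))"

lemma add_Node: "add (Node u p q) (Node v r s) = add_by (compare_jets u v) u p q v r s"
  by (simp add: add_by_def)

lemma add_by_simps:
  "add_by LT u p q v r s = Node u p (add q (Node v r s))"
  "add_by EQ u p q v r s = node u (add p r) (add q s)"
  "add_by GT u p q v r s = Node v r (add (Node u p q) s)"
  by (simp_all add: add_by_def)

lemma jet_mul_Node: "jet_mul v (Node u p q) = jet_mul_by (compare_jets u v) v u p q"
  by (simp add: jet_mul_by_def)

lemma jet_mul_by_simps:
  "jet_mul_by LT v u p q = Node u (jet_mul v p) (jet_mul v q)"
  "jet_mul_by EQ v u p q = Node v (Node u p q) (Const 0)"
  "jet_mul_by GT v u p q = Node v (Node u p q) (Const 0)"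
  by (simp_all add: jet_mul_by_def)

text \<open>As a congruence rule this stops rewriting inside the summand while the index is still a bound
  variable.\<close>

lemma sum_directions_weak_cong: "sum_directions F = sum_directions F" ..

lemmas numeral_rules = arith_simps more_arith_simps arith_special rel_simps Num.inc.simps
  add_0_left add_0_right mult_zero_left mult_zero_right simp_thms if_True if_False

lemmas dpoly_rules = add.simps(1-3) add_Node add_by_simps jet_mul.simps(1) jet_mul_Node jet_mul_by_simps
  scale.simps mul.simps node.simps ddiff.simps raise.simps insert_direction.simps
  compare_jets.simps compare_directions.simps sum_directions_def epsilon.simps nambu_dpoly_def

lemmas graph_rules = field_component.simps component_sum.simps monomial.simps raise_along.simps
  layout_def inner_vertices_def sink_edge_def in_edges_def out_edges_def micrograph.sel fst_conv snd_conv
  filter.simps list.map list.sel upt.simps le0 Suc_le_mono not_less_eq_eq le_zero_eq nat.distinct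
  list.size(3) length_Cons append_Nil append_Cons nth_Cons_0 nth_Cons_Suc direction.distinct
  labellings_def permutations3_def product.simps split_conv

lemmas component_rules = X_components_def X_component_def X_tetra_def defects_def defect_def
  bracket_dpoly_def select.simps flow_dpoly_def flow_term1_def flow_term2_def

text \<open>The expansion proper. Restricting rewriting to the defining equations and to arithmetic on numerals
  makes it an evaluation.\<close>

lemma defects_zero: "defects X_components = [Const 0, Const 0, Const 0]"
  by (simp only: component_rules graph_rules dpoly_rules numeral_rules cong: if_weak_cong sum_directions_weak_cong)

context smooth_pair
begin

definition X_coefficient :: "3 \<Rightarrow> scalar_field" where
  "X_coefficient k = val (X_component (THE i. index i = k))"

definition bracket_coefficient :: "3 \<Rightarrow> 3 \<Rightarrow> scalar_field" where
  "bracket_coefficient i j = (\<lambda>x. \<Sum>k\<in>UNIV. - (X_coefficient k x * partial k (P i j) x)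
     + (P k j x * partial k (X_coefficient i) x + P i k x * partial k (X_coefficient j) x))"

lemma X_coefficient_index: "X_coefficient (index i) = val (X_component i)"
  by (simp add: X_coefficient_def)

lemma encoded_field_X_tetra:
  "encoded_field X_tetra \<rho> a h x = (\<Sum>k\<in>UNIV. X_coefficient k x * partial k h x)"
  using X_coefficient_index[of E1] X_coefficient_index[of E2] X_coefficient_index[of E3]
  by (simp add: encoded_field_components[OF trident_micrographs_X_tetra] sum_3 X_component_def)

lemma select_X_components: "select X_components i = X_component i"
  by (cases i) (simp_all add: X_components_def)

lemma val_bracket_dpoly:
  "val (bracket_dpoly X_components i j) x = bracket_coefficient (index i) (index j) x"
  unfolding val_def bracket_dpoly_def bracket_coefficient_def
  by (rule ev_sum_directionsI)
    (simp add: nambu_index X_coefficient_index partial_val select_X_components fun_cong[OF val_def] del: index.simps)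

lemma bracket_coefficient_swap: "bracket_coefficient j i x = - bracket_coefficient i j x"
  unfolding bracket_coefficient_def sum_negf[symmetric]
proof (rule sum.cong)
  fix k
  show "- (X_coefficient k x * partial k (P j i) x)
      + (P k i x * partial k (X_coefficient j) x + P j k x * partial k (X_coefficient i) x)
    = - (- (X_coefficient k x * partial k (P i j) x)
      + (P k j x * partial k (X_coefficient i) x + P i k x * partial k (X_coefficient j) x))"
    by (simp add: partial_nambu_swap(1)[of k i j] fun_cong[OF nambu_swap[of i k]] fun_cong[OF nambu_swap[of k j]])
qed simp

lemma flow_eq_bracket: "8 * tetra_flow P i j x = bracket_coefficient i j x"
proof -
  have val_Const: "val (Const 0) x = 0" by (simp add: val_def)
  have defect: "8 * tetra_flow P (index i) (index j) x = bracket_coefficient (index i) (index j) x"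
    if "defect X_components i j = Const 0" for i j
    using val_Const unfolding that[symmetric] tetra_flow_index val_bracket_dpoly[symmetric]
    by (simp add: val_def defect_def)
  have pos: "8 * tetra_flow P 1 2 x = bracket_coefficient 1 2 x"
    "8 * tetra_flow P 2 3 x = bracket_coefficient 2 3 x"
    "8 * tetra_flow P 3 1 x = bracket_coefficient 3 1 x"
    using defect[of E1 E2] defect[of E2 E3] defect[of E3 E1] defects_zero by (simp_all add: defects_def)
  \<comment> \<open>Antisymmetry of both sides gives the other six components, those on the diagonal being zero.\<close>
  have neg: "8 * tetra_flow P l k x = bracket_coefficient l k x"
    if "8 * tetra_flow P k l x = bracket_coefficient k l x" for k l
    using that tetra_flow_swap[of l k x] bracket_coefficient_swap[of l k x] by simp
  have diag: "8 * tetra_flow P k k x = bracket_coefficient k k x" for k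
    using tetra_flow_swap[of k k x] bracket_coefficient_swap[of k k x] by simp
  show ?thesis
    using exhaust_3[of i] exhaust_3[of j] pos neg[OF pos(1)] neg[OF pos(2)] neg[OF pos(3)] diag
    by (elim disjE) simp_all
qed

end

theorem mainTheorem1:
  fixes \<rho> a f g :: "real^3 \<Rightarrow> real" and x :: "real^3"
  assumes "smooth \<rho>" and "smooth a" and "smooth f" and "smooth g"
  shows "8 * bivector_apply (tetra_flow (nambu \<rho> a)) f g x
         = schouten (nambu \<rho> a) (encoded_field X_tetra \<rho> a) f g x"
proof -
  interpret smooth_pair \<rho> a
    using assms by unfold_locales
  have "P i j differentiable at y" "X_coefficient k differentiable at y" for i j k y
    by (metis index_cases nambu_index val_differentiable) (simp add: X_coefficient_def val_differentiable)
  then have "schouten P (encoded_field X_tetra \<rho> a) f g x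
    = (\<Sum>i\<in>UNIV. \<Sum>j\<in>UNIV. bracket_coefficient i j x * partial i f x * partial j g x)"
    unfolding bracket_coefficient_def
    by (intro schouten_components encoded_field_X_tetra assms)
  then show ?thesis
    by (simp add: bivector_apply_def sum_distrib_left mult.assoc flip: flow_eq_bracket)
qed

end
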